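(* Let $C\subseteq\mathbb{R}^n$ be a nonempty polytope (the convex hull of a finite set), let $f:C\times C\to\mathbb{R}$ satisfy $f(x,x)=0$ for all $x\in C$, and let $K:C\rightrightarrows C$ be a set-valued map. Define $F:C\rightrightarrows C$ by $F(x):=\{y\in C: f(x,y)<0\}$. Assume that $K$ is lower semicontinuous with nonempty convex values and that $\operatorname{fix}K$ is closed. Moreover suppose that (i) $F(x)$ is convex for every $x\in\operatorname{fix}K$; (ii) $F$ has open lower sections on $\operatorname{fix}K$; (iii) $F(x)$ is open in $C$ for all $x\in\partial_C\operatorname{fix}K$. Then the quasiequilibrium problem has a solution, i.e. there exists $x\in C$ such that $x\in K(x)$ and $f(x,y)\ge 0$ for all $y\in K(x)$.
   Context: A set-valued map $\Phi:X\rightrightarrows Y$ between topological spaces assigns to each $x\in X$ a (possibly empty) subset $\Phi(x)\subseteq Y$. It is lower semicontinuous at $x$ if for each open set $\Omega$ with $\Phi(x)\cap\Omega\neq\emptyset$ there is a neighborhood $U_x$ of $x$ such that $\Phi(x')\cap\Omega\neq\emptyset$ for all $x'\in U_x$; it is lower semicontinuous if it is so at every point. The lower section of $\Phi$ at $y\in Y$ is $\Phi^{-1}(y):=\{x\in X: y\in\Phi(x)\}$; "$\Phi$ has open lower sections on $S$", for $S\subseteq X$, means that $\Phi^{-1}(y)\cap S$ is open in the relative topology of $S$ for every $y\in Y$. $\operatorname{fix}K:=\{x\in C: x\in K(x)\}$. For $A\subseteq C$, $\operatorname{int}_CA$ and $\operatorname{cl}_CA$ are the interior and closure of $A$ in the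 relative topology of $C$, and $\partial_CA:=\operatorname{cl}_CA\setminus\operatorname{int}_CA$. *)

theory Defs
  imports "HOL-Analysis.Analysis"
begin

text \<open>
  A set-valued map from a topological space \<open>X\<close> to a topological space \<open>Y\<close> is a function
  \<open>\<Phi> \<in> topspace X \<rightarrow> Pow (topspace Y)\<close>; its values outside \<open>topspace X\<close> are irrelevant, and
  empty values are allowed.
\<close>

definition lower_semicontinuous_at ::
    "'a topology \<Rightarrow> 'b topology \<Rightarrow> ('a \<Rightarrow> 'b set) \<Rightarrow> 'a \<Rightarrow> bool" where
  "lower_semicontinuous_at X Y \<Phi> x \<longleftrightarrow>
     (\<forall>\<Omega>. openin Y \<Omega> \<and> \<Phi> x \<inter> \<Omega> \<noteq> {} \<longrightarrow>
        (\<exists>U. openin X U \<and> x \<in> U \<and> (\<forall>x'\<in>U. \<Phi> x' \<inter> \<Omega> \<noteq> {})))"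

definition lower_semicontinuous ::
    "'a topology \<Rightarrow> 'b topology \<Rightarrow> ('a \<Rightarrow> 'b set) \<Rightarrow> bool" where
  "lower_semicontinuous X Y \<Phi> \<longleftrightarrow> (\<forall>x\<in>topspace X. lower_semicontinuous_at X Y \<Phi> x)"

definition lower_section :: "'a topology \<Rightarrow> ('a \<Rightarrow> 'b set) \<Rightarrow> 'b \<Rightarrow> 'a set" where
  "lower_section X \<Phi> y = {x \<in> topspace X. y \<in> \<Phi> x}"

definition open_lower_sections_on ::
    "'a topology \<Rightarrow> 'b topology \<Rightarrow> ('a \<Rightarrow> 'b set) \<Rightarrow> 'a set \<Rightarrow> bool" where
  "open_lower_sections_on X Y \<Phi> S \<longleftrightarrow>
     (\<forall>y\<in>topspace Y. openin (subtopology X S) (lower_section X \<Phi> y \<inter> S))"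

definition fixed_points :: "'a set \<Rightarrow> ('a \<Rightarrow> 'a set) \<Rightarrow> 'a set" where
  "fixed_points C K = {x \<in> C. x \<in> K x}"

end

theory Submission
  imports Defs
begin

text \<open>
  Suppose there is no solution, so that \<open>F x \<inter> K x \<noteq> {}\<close> on \<open>S = fix K\<close>. Let \<open>G\<close> be \<open>F\<close> on the
  relative interior of \<open>S\<close>, \<open>F \<inter> K\<close> on its boundary and \<open>K\<close> off \<open>S\<close>. Then \<open>G\<close> is lower
  semicontinuous with nonempty convex values, hence has a fixed point \<open>x\<close>; but \<open>x \<in> F x\<close> contradicts
  \<open>f x x = 0\<close>, and \<open>x \<in> K x\<close> is impossible off \<open>S\<close>.

  The values of \<open>G\<close> need not be closed, so the fixed point comes from Michael's selection theorem for
  arbitrary convex values in finite dimension: the closures of the values have a countable family of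
  continuous selections that is pointwise dense, and a convex combination of all of them with positive
  weights lies in the relative interior of the value, hence in the value itself. Brouwer's theorem
  applies to this selection.
\<close>

section \<open>Lower semicontinuity in terms of open sets\<close>

lemma lower_semicontinuous_iff_openin:
  "lower_semicontinuous X Y \<Phi> \<longleftrightarrow>
    (\<forall>\<Omega>. openin Y \<Omega> \<longrightarrow> openin X {x \<in> topspace X. \<Phi> x \<inter> \<Omega> \<noteq> {}})"
  (is "?L \<longleftrightarrow> ?R")
proof
  assume L: ?L
  show ?R
  proof (intro allI impI)
    fix \<Omega> assume \<Omega>: "openin Y \<Omega>"
    show "openin X {x \<in> topspace X. \<Phi> x \<inter> \<Omega> \<noteq> {}}"
    proof (subst openin_subopen, intro ballI)
      fix x assume x: "x \<in> {x \<in> topspace X. \<Phi> x \<inter> \<Omega> \<noteq> {}}"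
      then obtain U where "openin X U" "x \<in> U" "\<forall>x'\<in>U. \<Phi> x' \<inter> \<Omega> \<noteq> {}"
        using L \<Omega> unfolding lower_semicontinuous_def lower_semicontinuous_at_def by blast
      then show "\<exists>T. openin X T \<and> x \<in> T \<and> T \<subseteq> {x \<in> topspace X. \<Phi> x \<inter> \<Omega> \<noteq> {}}"
        using openin_subset by blast
    qed
  qed
next
  assume R: ?R
  show ?L
    unfolding lower_semicontinuous_def lower_semicontinuous_at_def
  proof (intro ballI allI impI)
    fix x \<Omega> assume "x \<in> topspace X" "openin Y \<Omega> \<and> \<Phi> x \<inter> \<Omega> \<noteq> {}"
    with R show "\<exists>U. openin X U \<and> x \<in> U \<and> (\<forall>x'\<in>U. \<Phi> x' \<inter> \<Omega> \<noteq> {})"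
      by (intro exI[of _ "{x \<in> topspace X. \<Phi> x \<inter> \<Omega> \<noteq> {}}"]) auto
  qed
qed

lemma lower_semicontinuous_onD:
  assumes "lower_semicontinuous (top_of_set S) euclidean H" "x \<in> S" "open \<Omega>" "H x \<inter> \<Omega> \<noteq> {}"
  obtains U where "openin (top_of_set S) U" "x \<in> U" "\<And>x'. x' \<in> U \<Longrightarrow> H x' \<inter> \<Omega> \<noteq> {}"
  using assms unfolding lower_semicontinuous_def lower_semicontinuous_at_def by force

lemma lower_semicontinuous_onI:
  assumes "\<And>x \<Omega>. x \<in> S \<Longrightarrow> open \<Omega> \<Longrightarrow> H x \<inter> \<Omega> \<noteq> {} \<Longrightarrow>
    \<exists>U. openin (top_of_set S) U \<and> x \<in> U \<and> (\<forall>x'\<in>U. H x' \<inter> \<Omega> \<noteq> {})"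
  shows "lower_semicontinuous (top_of_set S) euclidean H"
  using assms unfolding lower_semicontinuous_def lower_semicontinuous_at_def by simp

section \<open>Continuous selections of the closures of convex values\<close>

text \<open>By lower semicontinuity the points whose value meets \<open>ball y \<epsilon>\<close>
  form a relatively open set for each \<open>y\<close>, and these sets cover \<open>S\<close>. A
  partition of unity averages finitely many such centres; the average stays within \<epsilon> of
  \<open>H x\<close> because the \<epsilon>-neighbourhood of a convex set is convex.\<close>

lemma approximate_selection:
  fixes H :: "'a::metric_space \<Rightarrow> 'b::real_normed_vector set"
  assumes S: "compact S" and lsc: "lower_semicontinuous (top_of_set S) euclidean H"
    and H: "\<And>x. x \<in> S \<Longrightarrow> H x \<noteq> {} \<and> convex (H x)" and "\<epsilon> > 0"
  obtains f where "continuous_on S f" "\<And>x. x \<in> S \<Longrightarrow> H x \<inter> ball (f x) \<epsilon> \<noteq> {}"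
proof -
  have "\<exists>T. open T \<and> {x \<in> S. H x \<inter> ball y \<epsilon> \<noteq> {}} = S \<inter> T" for y
    using lsc unfolding lower_semicontinuous_iff_openin
    by (auto simp: openin_open)
  then obtain T where T: "\<And>y. open (T y)" "\<And>y. {x \<in> S. H x \<inter> ball y \<epsilon> \<noteq> {}} = S \<inter> T y"
    by metis
  have "S \<subseteq> (\<Union>y\<in>UNIV. T y)"
  proof
    fix x assume "x \<in> S"
    then obtain y where "y \<in> H x" using H by blast
    then have "x \<in> {x \<in> S. H x \<inter> ball y \<epsilon> \<noteq> {}}" using \<open>x \<in> S\<close> \<open>\<epsilon> > 0\<close> by (metis (mono_tags, lifting) IntI centre_in_ball empty_iff mem_Collect_eq)
    then show "x \<in> (\<Union>y\<in>UNIV. T y)" using T(2) by blast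
  qed
  then obtain D where D: "finite D" "S \<subseteq> (\<Union>y\<in>D. T y)"
    using compactE_image[OF S, of UNIV T] T(1) by metis
  define \<C> where "\<C> = T ` D"
  have fin: "finite \<C>" using D by (simp add: \<C>_def)
  obtain F :: "['a set, 'a] \<Rightarrow> real" where
      F: "\<And>U. U \<in> \<C> \<Longrightarrow> continuous_on S (F U) \<and> (\<forall>x \<in> S. 0 \<le> F U x)"
        "\<And>x U. \<lbrakk>U \<in> \<C>; x \<in> S; x \<notin> U\<rbrakk> \<Longrightarrow> F U x = 0"
        "\<And>x. x \<in> S \<Longrightarrow> supp_sum (\<lambda>W. F W x) \<C> = 1"
  proof (rule subordinate_partition_of_unity[of S \<C>])
    show "S \<subseteq> \<Union>\<C>" using D by (simp add: \<C>_def)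
    show "\<And>T. T \<in> \<C> \<Longrightarrow> open T" using T by (auto simp: \<C>_def)
    show "\<exists>V. open V \<and> x \<in> V \<and> finite {U \<in> \<C>. U \<inter> V \<noteq> {}}" for x
      using fin by (intro exI[of _ UNIV]) auto
  qed blast
  \<comment> \<open>The partition of unity is indexed by sets, and \<open>T\<close> need not be
    injective on \<open>D\<close>; \<open>c\<close> picks one centre for each set.\<close>
  define c where "c = inv_into D T"
  define f where "f x = (\<Sum>U\<in>\<C>. F U x *\<^sub>R c U)" for x
  have Tc: "T (c U) = U" if "U \<in> \<C>" for U
    using that unfolding \<C>_def c_def by (simp add: f_inv_into_f)
  show thesis
  proof
    show "continuous_on S f"
      unfolding f_def using F(1) by (intro continuous_intros) auto
    fix x assume x: "x \<in> S"
    \<comment> \<open>The \<epsilon>-neighbourhood of \<open>H x\<close> is written as a Minkowski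
      sum with a ball, which gives its convexity at once.\<close>
    let ?N = "{h + b | h b. h \<in> H x \<and> b \<in> ball 0 \<epsilon>}"
    have N: "y \<in> ?N \<longleftrightarrow> H x \<inter> ball y \<epsilon> \<noteq> {}" for y
    proof
      assume "H x \<inter> ball y \<epsilon> \<noteq> {}"
      then obtain h where "h \<in> H x" "dist y h < \<epsilon>" by auto
      then have "y = h + (y - h) \<and> h \<in> H x \<and> y - h \<in> ball 0 \<epsilon>"
        by (simp add: dist_norm norm_minus_commute)
      then show "y \<in> ?N" by blast
    next
      assume "y \<in> ?N"
      then show "H x \<inter> ball y \<epsilon> \<noteq> {}" by (force simp: dist_norm)
    qed
    \<comment> \<open>Only for sets containing \<open>x\<close> is the centre known to lie in
      \<open>?N\<close>; the others have weight 0 at \<open>x\<close> and drop out.\<close>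
    let ?\<C> = "{U \<in> \<C>. x \<in> U}"
    have "(\<Sum>U\<in>?\<C>. F U x *\<^sub>R c U) \<in> ?N"
    proof (rule convex_sum)
      have "?N = (\<Union>h\<in>H x. \<Union>b\<in>ball 0 \<epsilon>. {h + b})" by blast
      then show "convex ?N" using convex_sums[of "H x" "ball 0 \<epsilon>"] H[OF x] by simp
      have "supp_sum (\<lambda>W. F W x) \<C> = (\<Sum>U\<in>?\<C>. F U x)"
        unfolding supp_sum_def support_on_def
        using fin F(2)[OF _ x] by (intro sum.mono_neutral_left) auto
      then show "(\<Sum>U\<in>?\<C>. F U x) = 1" using F(3)[OF x] by simp
      show "c U \<in> ?N" if "U \<in> ?\<C>" for U
        unfolding N using T(2)[of "c U"] Tc[of U] that x by blast
    qed (use fin F x in auto)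
    moreover have "(\<Sum>U\<in>?\<C>. F U x *\<^sub>R c U) = f x"
      unfolding f_def using fin F(2)[OF _ x] by (intro sum.mono_neutral_left) auto
    ultimately show "H x \<inter> ball (f x) \<epsilon> \<noteq> {}" using N by simp
  qed
qed

text \<open>This allows each approximate selection to be tied to its predecessor. The strict
  inequality defining the open ball leaves slack for the movement of both the centre and the chosen
  point.\<close>

lemma lower_semicontinuous_Int_ball:
  fixes H :: "'a::metric_space \<Rightarrow> 'b::metric_space set"
  assumes lsc: "lower_semicontinuous (top_of_set S) euclidean H" and f: "continuous_on S f"
  shows "lower_semicontinuous (top_of_set S) euclidean (\<lambda>x. H x \<inter> ball (f x) r)"
proof (rule lower_semicontinuous_onI)
  fix x \<Omega> assume x: "x \<in> S" and "open \<Omega>" and "H x \<inter> ball (f x) r \<inter> \<Omega> \<noteq> {}"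
  then obtain y where y: "y \<in> H x" "dist (f x) y < r" "y \<in> \<Omega>" by auto
  \<comment> \<open>Half of the slack pays for moving \<open>f x\<close> to \<open>f x'\<close>, the
    other half for replacing \<open>y\<close> by a point of \<open>H x'\<close>.\<close>
  define \<delta> where "\<delta> = (r - dist (f x) y) / 2"
  have \<delta>: "\<delta> > 0" using y by (simp add: \<delta>_def)
  obtain U where U: "openin (top_of_set S) U" "x \<in> U"
      "\<And>x'. x' \<in> U \<Longrightarrow> H x' \<inter> (\<Omega> \<inter> ball y \<delta>) \<noteq> {}"
    using lower_semicontinuous_onD[OF lsc x, of "\<Omega> \<inter> ball y \<delta>"] \<open>open \<Omega>\<close> y \<delta>
    by (metis Int_iff centre_in_ball emptyE open_Int open_ball)
  let ?V = "S \<inter> f -` ball (f x) \<delta>"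
  have V: "openin (top_of_set S) ?V"
    using f by (intro continuous_openin_preimage_gen) auto
  have "H x' \<inter> ball (f x') r \<inter> \<Omega> \<noteq> {}" if x': "x' \<in> U \<inter> ?V" for x'
  proof -
    obtain z where z: "z \<in> H x'" "z \<in> \<Omega>" "dist y z < \<delta>" using U(3)[of x'] x' by auto
    have "dist (f x') z \<le> dist (f x) (f x') + dist (f x) y + dist y z"
      by metric
    also have "\<dots> < r" using z x' by (simp add: \<delta>_def field_simps)
    finally show ?thesis using z by auto
  qed
  then show "\<exists>U. openin (top_of_set S) U \<and> x \<in> U \<and> (\<forall>x'\<in>U. H x' \<inter> ball (f x') r \<inter> \<Omega> \<noteq> {})"
    using U V x \<delta> by (intro exI[of _ "U \<inter> ?V"]) auto
qed

text \<open>Each approximate selection is built for the values cut down to small balls around the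
  preceding one, so successive distances are summable and the sequence converges uniformly. The
  limit has distance 0 from \<open>H x\<close>, which places it in the closure.\<close>

lemma closure_selection:
  fixes H :: "'a::metric_space \<Rightarrow> 'b::banach set"
  assumes S: "compact S" and lsc: "lower_semicontinuous (top_of_set S) euclidean H"
    and H: "\<And>x. x \<in> S \<Longrightarrow> H x \<noteq> {} \<and> convex (H x)"
  obtains f where "continuous_on S f" "\<And>x. x \<in> S \<Longrightarrow> f x \<in> closure (H x)"
proof -
  define \<epsilon> where "\<epsilon> n = (1/2::real) ^ n" for n
  have \<epsilon>: "\<epsilon> n > 0" for n by (simp add: \<epsilon>_def)
  define P where "P n f \<longleftrightarrow> continuous_on S f \<and> (\<forall>x\<in>S. H x \<inter> ball (f x) (\<epsilon> n) \<noteq> {})" for n and f :: "'a \<Rightarrow> 'b"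
  have "\<exists>g. \<forall>n. P n (g n) \<and> (\<forall>x\<in>S. dist (g n x) (g (Suc n) x) < 2 * \<epsilon> n)"
  proof (rule dependent_nat_choice)
    show "\<exists>f. P 0 f"
      using approximate_selection[OF S lsc H \<epsilon>] unfolding P_def by metis
    fix f n assume f: "P n f"
    let ?H = "\<lambda>x. H x \<inter> ball (f x) (\<epsilon> n)"
    obtain g where g: "continuous_on S g" "\<And>x. x \<in> S \<Longrightarrow> ?H x \<inter> ball (g x) (\<epsilon> (Suc n)) \<noteq> {}"
    proof (rule approximate_selection[OF S, of ?H "\<epsilon> (Suc n)"])
      show "lower_semicontinuous (top_of_set S) euclidean ?H"
        using f by (intro lower_semicontinuous_Int_ball lsc) (simp add: P_def)
      show "?H x \<noteq> {} \<and> convex (?H x)" if "x \<in> S" for x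
        using f H[OF that] that by (auto simp: P_def intro: convex_Int)
    qed (use \<epsilon> in auto)
    have "dist (f x) (g x) < 2 * \<epsilon> n" if x: "x \<in> S" for x
    proof -
      obtain z where "dist (f x) z < \<epsilon> n" "dist (g x) z < \<epsilon> (Suc n)" using g(2)[OF x] by auto
      then have "dist (f x) (g x) < \<epsilon> n + \<epsilon> (Suc n)" by metric
      also have "\<dots> \<le> 2 * \<epsilon> n" by (simp add: \<epsilon>_def)
      finally show ?thesis .
    qed
    moreover have "P (Suc n) g" using g unfolding P_def by blast
    ultimately show "\<exists>g. P (Suc n) g \<and> (\<forall>x\<in>S. dist (f x) (g x) < 2 * \<epsilon> n)" by blast
  qed
  then obtain g where g: "\<And>n. continuous_on S (g n)"
      "\<And>n x. x \<in> S \<Longrightarrow> H x \<inter> ball (g n x) (\<epsilon> n) \<noteq> {}"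
      "\<And>n x. x \<in> S \<Longrightarrow> dist (g n x) (g (Suc n) x) < 2 * \<epsilon> n"
    unfolding P_def by blast
  \<comment> \<open>As a telescoping series the sequence falls under the Weierstrass M-test;
    \<open>h\<close> is the limit of \<open>g n - g 0\<close>, so \<open>?f\<close> adds
    \<open>g 0\<close> back.\<close>
  define h where "h x = (\<Sum>k. g (Suc k) x - g k x)" for x
  have "uniform_limit S (\<lambda>n x. \<Sum>k<n. g (Suc k) x - g k x) h sequentially"
    unfolding h_def
  proof (rule Weierstrass_m_test)
    show "norm (g (Suc n) x - g n x) \<le> 2 * \<epsilon> n" if "x \<in> S" for n x
      using g(3)[OF that, of n] by (simp add: dist_norm norm_minus_commute)
    show "summable (\<lambda>n. 2 * \<epsilon> n)"
      unfolding \<epsilon>_def by (intro summable_mult summable_geometric) simp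
  qed
  then have lim: "uniform_limit S (\<lambda>n x. g n x - g 0 x) h sequentially"
    using sum_lessThan_telescope[of "\<lambda>k. g k x" for x] by simp
  let ?f = "\<lambda>x. h x + g 0 x"
  show thesis
  proof
    have "continuous_on S h"
      by (rule uniform_limit_theorem[OF _ lim])
        (auto intro!: always_eventually continuous_on_diff g)
    then show "continuous_on S ?f" using g(1) by (intro continuous_intros)
    fix x assume x: "x \<in> S"
    have "(\<lambda>n. g n x - g 0 x + g 0 x) \<longlonglongrightarrow> h x + g 0 x"
      by (intro tendsto_intros tendsto_uniform_limitI[OF lim x])
    then have gl: "(\<lambda>n. g n x) \<longlonglongrightarrow> ?f x" by simp
    obtain z where z: "\<And>n. z n \<in> H x" "\<And>n. dist (g n x) (z n) < \<epsilon> n"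
      using g(2)[OF x] unfolding disjoint_iff mem_ball by metis
    have \<epsilon>0: "\<epsilon> \<longlonglongrightarrow> 0" unfolding \<epsilon>_def by (intro LIMSEQ_realpow_zero) auto
    have "(\<lambda>n. dist (g n x) (z n)) \<longlonglongrightarrow> 0"
    proof (rule tendsto_sandwich[OF _ _ tendsto_const \<epsilon>0])
      show "\<forall>\<^sub>F n in sequentially. dist (g n x) (z n) \<le> \<epsilon> n"
        using z(2) by (intro always_eventually allI less_imp_le)
    qed simp
    then have "(\<lambda>n. g n x - z n) \<longlonglongrightarrow> 0"
      by (simp add: dist_norm tendsto_norm_zero_iff)
    from tendsto_diff[OF gl this] have "z \<longlonglongrightarrow> ?f x" by simp
    then show "?f x \<in> closure (H x)" using z(1) unfolding closure_sequential by blast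
  qed
qed

text \<open>The values are cut down to \<open>H x \<inter> B\<close> on \<open>A\<close>. This keeps
  lower semicontinuity: at a point of \<open>A\<close> the test set is shrunk by the open set
  \<open>B\<close>, and a point outside \<open>A\<close> has a neighbourhood that avoids
  \<open>A\<close>.\<close>

lemma closure_selection_constrained:
  fixes H :: "'a::metric_space \<Rightarrow> 'b::banach set"
  assumes S: "compact S" and lsc: "lower_semicontinuous (top_of_set S) euclidean H"
    and H: "\<And>x. x \<in> S \<Longrightarrow> H x \<noteq> {} \<and> convex (H x)"
    and A: "closedin (top_of_set S) A" and B: "open B" "convex B"
    and AB: "\<And>x. x \<in> A \<Longrightarrow> H x \<inter> B \<noteq> {}"
  obtains f where "continuous_on S f" "\<And>x. x \<in> S \<Longrightarrow> f x \<in> closure (H x)"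
    "\<And>x. x \<in> A \<Longrightarrow> f x \<in> closure B"
proof -
  let ?H = "\<lambda>x. if x \<in> A then H x \<inter> B else H x"
  obtain f where f: "continuous_on S f" "\<And>x. x \<in> S \<Longrightarrow> f x \<in> closure (?H x)"
  proof (rule closure_selection[OF S, of ?H])
    show "lower_semicontinuous (top_of_set S) euclidean ?H"
    proof (rule lower_semicontinuous_onI)
      fix x \<Omega> assume x: "x \<in> S" and \<Omega>: "open \<Omega>" "?H x \<inter> \<Omega> \<noteq> {}"
      show "\<exists>U. openin (top_of_set S) U \<and> x \<in> U \<and> (\<forall>x'\<in>U. ?H x' \<inter> \<Omega> \<noteq> {})"
      proof (cases "x \<in> A")
        case True
        then obtain U where "openin (top_of_set S) U" "x \<in> U"
          "\<And>x'. x' \<in> U \<Longrightarrow> H x' \<inter> (B \<inter> \<Omega>) \<noteq> {}"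
          using lower_semicontinuous_onD[OF lsc x, of "B \<inter> \<Omega>"] \<Omega> B(1)
          by (auto simp: Int_assoc)
        then show ?thesis by (intro exI[of _ U]) auto
      next
        case False
        then obtain U where U: "openin (top_of_set S) U" "x \<in> U"
          "\<And>x'. x' \<in> U \<Longrightarrow> H x' \<inter> \<Omega> \<noteq> {}"
          using lower_semicontinuous_onD[OF lsc x \<Omega>(1)] \<Omega> by auto
        have "openin (top_of_set S) (S - A)" using A by (simp add: closedin_def)
        then show ?thesis using U False x by (intro exI[of _ "U \<inter> (S - A)"]) auto
      qed
    qed
    show "?H x \<noteq> {} \<and> convex (?H x)" if "x \<in> S" for x
      using H[OF that] AB[of x] B by (auto intro: convex_Int)
  qed blast
  show thesis
  proof
    show "f x \<in> closure (H x)" if "x \<in> S" for x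
      using f(2)[OF that] closure_mono[of "?H x" "H x"] by (auto split: if_splits)
    show "f x \<in> closure B" if "x \<in> A" for x
    proof -
      have "x \<in> S" using A that closedin_subset by fastforce
      then show ?thesis using f(2)[of x] that closure_mono[of "?H x" B] by auto
    qed
  qed (use f in auto)
qed

section \<open>Selections of convex values in finite dimension\<close>

text \<open>For every small ball around a point of a countable dense set, selections landing in its
  closure are wanted wherever \<open>H\<close> meets the ball. Those points form a relatively open
  set, while constrained selections are prescribed on closed sets; hence the set is exhausted by
  countably many closed ones.\<close>

lemma dense_closure_selections:
  fixes H :: "'a::metric_space \<Rightarrow> 'b::{banach,second_countable_topology} set"
  assumes S: "compact S" and lsc: "lower_semicontinuous (top_of_set S) euclidean H"
    and H: "\<And>x. x \<in> S \<Longrightarrow> H x \<noteq> {} \<and> convex (H x)"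
  obtains p :: "nat \<Rightarrow> 'a \<Rightarrow> 'b" where "\<And>i. continuous_on S (p i)"
    "\<And>i x. x \<in> S \<Longrightarrow> p i x \<in> closure (H x)"
    "\<And>x. x \<in> S \<Longrightarrow> H x \<subseteq> closure (range (\<lambda>i. p i x))"
proof -
  obtain D :: "'b set" where D: "countable D" "\<And>X. open X \<Longrightarrow> X \<noteq> {} \<Longrightarrow> \<exists>d \<in> D. d \<in> X"
    by (rule countable_dense_setE) blast
  define r where "r n = inverse (real (Suc n))" for n
  have r: "r n > 0" for n by (simp add: r_def)
  \<comment> \<open>These are the points of \<open>S\<close> at distance at least \<open>r k\<close>
    from every point of \<open>S\<close> whose value misses the ball; as \<open>k\<close> grows they
    exhaust the points whose value meets it.\<close>
  define A where "A d n k = S - (\<Union>w\<in>{w \<in> S. H w \<inter> ball d (r n) = {}}. ball w (r k))" for d n k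
  have "\<exists>f. continuous_on S f \<and> (\<forall>x\<in>S. f x \<in> closure (H x)) \<and> (\<forall>x\<in>A d n k. f x \<in> cball d (r n))"
    for d n k
  proof -
    have "closedin (top_of_set S) (A d n k)"
      unfolding A_def
      by (metis (no_types, lifting) closedin_closed_Int closed_Compl Diff_eq open_UN open_ball)
    moreover have "H x \<inter> ball d (r n) \<noteq> {}" if "x \<in> A d n k" for x
      using that r[of k] unfolding A_def by auto
    ultimately obtain f where "continuous_on S f" "\<And>x. x \<in> S \<Longrightarrow> f x \<in> closure (H x)"
      "\<And>x. x \<in> A d n k \<Longrightarrow> f x \<in> closure (ball d (r n))"
      using closure_selection_constrained[OF S lsc H, of "A d n k" "ball d (r n)"] by auto
    then show ?thesis using r[of n] by (intro exI[of _ f]) auto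
  qed
  then obtain q where q: "\<And>d n k. continuous_on S (q d n k)"
    "\<And>d n k x. x \<in> S \<Longrightarrow> q d n k x \<in> closure (H x)"
    "\<And>d n k x. x \<in> A d n k \<Longrightarrow> q d n k x \<in> cball d (r n)"
    by metis
  define \<Q> where "\<Q> = (\<lambda>(d, n, k). q d n k) ` (D \<times> UNIV \<times> UNIV)"
  have "D \<noteq> {}" using D(2)[of UNIV] by auto
  then have \<Q>: "countable \<Q>" "\<Q> \<noteq> {}" using D(1) by (auto simp: \<Q>_def)
  define p where "p = from_nat_into \<Q>"
  have range_p: "range p = \<Q>" using \<Q> by (simp add: p_def range_from_nat_into)
  show thesis
  proof
    have p: "\<exists>d n k. p i = q d n k" for i
    proof -
      have "p i \<in> \<Q>" using range_p by blast
      then show ?thesis by (auto simp: \<Q>_def)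
    qed
    show "continuous_on S (p i)" for i using p[of i] q(1) by auto
    show "p i x \<in> closure (H x)" if "x \<in> S" for i x using p[of i] q(2)[OF that] by auto
    fix x assume x: "x \<in> S"
    show "H x \<subseteq> closure (range (\<lambda>i. p i x))"
    proof
      fix y assume y: "y \<in> H x"
      show "y \<in> closure (range (\<lambda>i. p i x))"
        unfolding closure_approachable
      proof (intro allI impI)
        fix e :: real assume "e > 0"
        \<comment> \<open>Both \<open>y\<close> and the selected point will lie within
          \<open>r n\<close> of the centre \<open>d\<close>, hence the bound
          \<open>e / 2\<close>.\<close>
        then obtain n where n: "r n < e / 2" using reals_Archimedean[of "e/2"] by (auto simp: r_def)
        obtain d where d: "d \<in> D" "dist y d < r n"
          using D(2)[of "ball y (r n)"] r[of n] by auto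
        have "H x \<inter> ball d (r n) \<noteq> {}" using y d by (auto simp: dist_commute)
        then obtain U where U: "openin (top_of_set S) U" "x \<in> U"
          "\<And>x'. x' \<in> U \<Longrightarrow> H x' \<inter> ball d (r n) \<noteq> {}"
          using lower_semicontinuous_onD[OF lsc x open_ball] by metis
        then obtain \<delta> where \<delta>: "\<delta> > 0" "ball x \<delta> \<inter> S \<subseteq> U"
          unfolding openin_contains_ball by blast
        then obtain k where k: "r k < \<delta>" using reals_Archimedean[of \<delta>] by (auto simp: r_def)
        have "x \<notin> ball w (r k)" if "w \<in> S" "H w \<inter> ball d (r n) = {}" for w
        proof
          assume "x \<in> ball w (r k)"
          then have "w \<in> ball x \<delta> \<inter> S" using k that by (simp add: dist_commute)
          then show False using \<delta>(2) U(3) that(2) by blast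
        qed
        then have "x \<in> A d n k" unfolding A_def using x by blast
        then have "dist d (q d n k x) \<le> r n" using q(3) by auto
        then have "dist (q d n k x) y < e" using n d(2) by metric
        moreover have "q d n k \<in> range p"
          unfolding range_p \<Q>_def using d by (intro image_eqI[of _ _ "(d, n, k)"]) auto
        ultimately show "\<exists>z\<in>range (\<lambda>i. p i x). dist z y < e" by auto
      qed
    qed
  qed
qed

text \<open>Otherwise a supporting hyperplane at \<open>z\<close> gives a functional that is at
  least its value at \<open>z\<close> on all \<open>p i\<close>, and by density strictly larger at
  some \<open>p j\<close>. As all weights are positive, the weighted mean would exceed the value at
  \<open>z\<close>.\<close>

lemma countable_convex_combination_in_rel_interior:
  fixes A :: "'a::euclidean_space set" and w :: "nat \<Rightarrow> real"
  assumes A: "convex A" and p: "\<And>i. p i \<in> closure A" and dense: "A \<subseteq> closure (range p)"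
    and w: "\<And>i. w i > 0" "w sums 1" and z: "(\<lambda>i. w i *\<^sub>R p i) sums z"
  shows "z \<in> rel_interior A"
proof (rule ccontr)
  assume zn: "z \<notin> rel_interior A"
  have inner: "(\<lambda>i. w i * (a \<bullet> p i)) sums (a \<bullet> z)" for a
    using bounded_linear.sums[OF bounded_linear_inner_right z, of a] by simp
  have const: "(\<lambda>i. w i * b) sums b" for b using sums_mult2[OF w(2), of b] by simp
  have "z \<in> closure A"
  \<comment> \<open>A hyperplane strictly separating \<open>z\<close> from the closure is
    impossible, since \<open>z\<close> is a weighted mean of points on the other side.\<close>
  proof (rule ccontr)
    assume "z \<notin> closure A"
    then obtain a b where ab: "a \<bullet> z < b" "\<forall>x\<in>closure A. a \<bullet> x > b"
      using separating_hyperplane_closed_point[of "closure A" z] A by (auto simp: convex_closure)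
    have "b \<le> a \<bullet> z"
      by (rule sums_le[OF _ const inner]) (use ab p w(1) in \<open>auto intro!: mult_left_mono less_imp_le\<close>)
    then show False using ab by simp
  qed
  then obtain a where a: "\<And>y. y \<in> closure A \<Longrightarrow> a \<bullet> z \<le> a \<bullet> y"
      "\<And>y. y \<in> rel_interior A \<Longrightarrow> a \<bullet> z < a \<bullet> y"
    using supporting_hyperplane_relative_frontier[OF A _ zn] by metis
  have "A \<noteq> {}" using p[of 0] by auto
  then obtain y where y: "y \<in> rel_interior A" using rel_interior_eq_empty[OF A] by auto
  then have "y \<in> closure (range p)" using dense rel_interior_subset by blast
  moreover have "open {u. a \<bullet> z < a \<bullet> u}" by (rule open_halfspace_gt)
  ultimately have "range p \<inter> {u. a \<bullet> z < a \<bullet> u} \<noteq> {}"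
    using a(2)[OF y] by (auto simp: closure_iff_nhds_not_empty)
  then obtain j where j: "a \<bullet> z < a \<bullet> p j" by auto
  have *: "(\<lambda>i. w i * (a \<bullet> p i) - w i * (a \<bullet> z)) sums 0"
    using sums_diff[OF inner const[of "a \<bullet> z"], of a] by simp
  have "0 < (\<Sum>i. w i * (a \<bullet> p i) - w i * (a \<bullet> z))"
    by (rule suminf_pos2[OF sums_summable[OF *], of j])
      (use a(1)[OF p] w(1) j in \<open>auto intro!: mult_left_mono less_imp_le\<close>)
  then show False using * by (simp add: sums_iff)
qed

text \<open>Boundedness makes the weighted series of the dense selections converge uniformly. Its
  sum lies in the relative interior of \<open>H x\<close>, which brings the selection back from the
  closure into the value.\<close>

theorem finite_dimensional_selection:
  fixes H :: "'a::metric_space \<Rightarrow> 'b::euclidean_space set"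
  assumes S: "compact S" and lsc: "lower_semicontinuous (top_of_set S) euclidean H"
    and H: "\<And>x. x \<in> S \<Longrightarrow> H x \<noteq> {} \<and> convex (H x)" and bdd: "bounded (\<Union>x\<in>S. H x)"
  obtains f where "continuous_on S f" "\<And>x. x \<in> S \<Longrightarrow> f x \<in> H x"
proof -
  obtain p :: "nat \<Rightarrow> 'a \<Rightarrow> 'b" where p: "\<And>i. continuous_on S (p i)"
    "\<And>i x. x \<in> S \<Longrightarrow> p i x \<in> closure (H x)"
    "\<And>x. x \<in> S \<Longrightarrow> H x \<subseteq> closure (range (\<lambda>i. p i x))"
    using dense_closure_selections[OF S lsc H] by blast
  obtain M where M: "\<And>y. y \<in> closure (\<Union>x\<in>S. H x) \<Longrightarrow> norm y \<le> M"
    using bounded_closure[OF bdd] unfolding bounded_iff by blast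
  \<comment> \<open>The exponent starts at 1 so that the weights sum to 1.\<close>
  define w where "w i = (1/2::real) ^ Suc i" for i
  have w: "w i > 0" "w sums 1" for i
    using power_half_series by (auto simp: w_def[abs_def])
  define f where "f x = (\<Sum>i. w i *\<^sub>R p i x)" for x
  have bound: "norm (w i *\<^sub>R p i x) \<le> w i * M" if "x \<in> S" for i x
  proof -
    have "closure (H x) \<subseteq> closure (\<Union>x\<in>S. H x)" by (intro closure_mono) (use that in auto)
    then have "norm (p i x) \<le> M" using M p(2)[OF that] by blast
    then show ?thesis using w(1)[of i] by (simp add: mult_left_mono)
  qed
  have summ: "summable (\<lambda>i. w i * M)"
    using w(2) by (intro summable_mult2) (simp add: sums_iff)
  have lim: "uniform_limit S (\<lambda>n x. \<Sum>i<n. w i *\<^sub>R p i x) f sequentially"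
    unfolding f_def using bound summ by (rule Weierstrass_m_test)
  show thesis
  proof
    show "continuous_on S f"
      by (rule uniform_limit_theorem[OF _ lim])
        (auto intro!: always_eventually continuous_on_sum continuous_on_scaleR continuous_on_const p)
    fix x assume x: "x \<in> S"
    have "f x \<in> rel_interior (H x)"
    proof (rule countable_convex_combination_in_rel_interior[OF _ p(2)[OF x] p(3)[OF x] w])
      show "convex (H x)" using H[OF x] by simp
      show "(\<lambda>i. w i *\<^sub>R p i x) sums f x"
        unfolding f_def
        by (rule summable_sums, rule summable_comparison_test'[OF summ]) (rule bound[OF x])
    qed
    then show "f x \<in> H x" using rel_interior_subset by blast
  qed
qed

section \<open>Fixed points by Brouwer's theorem\<close>

corollary lower_semicontinuous_fixed_point:
  fixes C :: "'a::euclidean_space set"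
  assumes C: "compact C" "convex C" "C \<noteq> {}"
    and lsc: "lower_semicontinuous (top_of_set C) euclidean G"
    and G: "\<And>x. x \<in> C \<Longrightarrow> G x \<noteq> {} \<and> convex (G x) \<and> G x \<subseteq> C"
  obtains x where "x \<in> C" "x \<in> G x"
proof -
  have "bounded (\<Union>x\<in>C. G x)"
    by (rule bounded_subset[OF compact_imp_bounded[OF C(1)]]) (use G in auto)
  then obtain g where g: "continuous_on C g" "\<And>x. x \<in> C \<Longrightarrow> g x \<in> G x"
    using finite_dimensional_selection[OF C(1) lsc] G by metis
  then obtain x where "x \<in> C" "g x = x" using brouwer[OF C, of g] G by blast
  then show thesis using g(2) that by metis
qed

section \<open>The quasiequilibrium problem on a polytope\<close>

text \<open>This is the only place where \<open>C\<close> has to be a polytope: a neighbourhood of \<open>y\<close> in \<open>C\<close> is the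
  convex hull of finitely many points, each of which stays in \<open>F x'\<close> for \<open>x'\<close> near \<open>x\<close>.\<close>

lemma open_lower_sections_uniform_neighbourhood:
  fixes C :: "'a::euclidean_space set"
  assumes C: "polytope C"
    and ols: "open_lower_sections_on (top_of_set C) (top_of_set C) F S"
    and SC: "S \<subseteq> C" and conv: "\<And>x. x \<in> S \<Longrightarrow> convex (F x)"
    and x: "x \<in> S" and Fx: "openin (top_of_set C) (F x)" and y: "y \<in> F x"
  obtains U V where "openin (top_of_set S) U" "x \<in> U" "open V" "y \<in> V"
    "\<And>x'. x' \<in> U \<Longrightarrow> C \<inter> V \<subseteq> F x'"
proof -
  obtain W where W: "open W" "F x = C \<inter> W" using Fx by (auto simp: openin_open)
  obtain a b where ab: "cbox a b \<subseteq> W" "y \<in> box a b"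
    using open_contains_cbox[OF W(1), of y] y W(2) by (metis IntD2)
  have "polytope (C \<inter> cbox a b)" using C by (intro polytope_Int polytope_interval)
  then obtain E where E: "finite E" "C \<inter> cbox a b = convex hull E"
    unfolding polytope_def by auto
  have EF: "E \<subseteq> F x" using E(2) hull_subset[of E convex] W(2) ab(1) by blast
  have EC: "E \<subseteq> C" using EF W(2) by blast
  have "y \<in> C \<inter> cbox a b" using y W(2) ab(2) box_subset_cbox by blast
  \<comment> \<open>An intersection over an empty \<open>E\<close> would be the whole space instead
    of a relatively open subset of \<open>S\<close>.\<close>
  then have "E \<noteq> {}" using E(2) by auto
  let ?U = "\<Inter>e\<in>E. lower_section (top_of_set C) F e \<inter> S"
  have "openin (top_of_set S) ?U"
  proof (rule openin_INT2)
    show "openin (top_of_set S) (lower_section (top_of_set C) F e \<inter> S)" if "e \<in> E" for e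
    proof -
      have "subtopology (top_of_set C) S = top_of_set S"
        using SC by (simp add: subtopology_subtopology inf.absorb2)
      then show ?thesis using ols that EC unfolding open_lower_sections_on_def by auto
    qed
  qed (use E \<open>E \<noteq> {}\<close> in auto)
  moreover have "x \<in> ?U" using x SC EF by (auto simp: lower_section_def)
  moreover have "C \<inter> box a b \<subseteq> F x'" if "x' \<in> ?U" for x'
  proof -
    have "E \<subseteq> F x'" "x' \<in> S" using that \<open>E \<noteq> {}\<close> by (auto simp: lower_section_def)
    then have "convex hull E \<subseteq> F x'" using conv by (intro hull_minimal) auto
    then show ?thesis using E(2) box_subset_cbox[of a b] by blast
  qed
  ultimately show thesis using that[of ?U "box a b"] ab(2) by blast
qed

theorem theorem3p3:
  fixes C :: "(real ^ 'n) set"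
    and f :: "real ^ 'n \<Rightarrow> real ^ 'n \<Rightarrow> real"
    and K F :: "real ^ 'n \<Rightarrow> (real ^ 'n) set"
  assumes "polytope C" and "C \<noteq> {}"
    and "\<forall>x\<in>C. f x x = 0"
    and "K \<in> C \<rightarrow> Pow C"
    and "\<forall>x\<in>C. F x = {y \<in> C. f x y < 0}"
    and "lower_semicontinuous (top_of_set C) (top_of_set C) K"
    and "\<forall>x\<in>C. K x \<noteq> {} \<and> convex (K x)"
    and "closedin (top_of_set C) (fixed_points C K)"
    and "\<forall>x\<in>fixed_points C K. convex (F x)"
    and "open_lower_sections_on (top_of_set C) (top_of_set C) F (fixed_points C K)"
    and "\<forall>x\<in>top_of_set C frontier_of fixed_points C K. openin (top_of_set C) (F x)"
  shows "\<exists>x\<in>C. x \<in> K x \<and> (\<forall>y\<in>K x. f x y \<ge> 0)"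
proof (rule ccontr)
  assume no: "\<not> (\<exists>x\<in>C. x \<in> K x \<and> (\<forall>y\<in>K x. f x y \<ge> 0))"
  define S where "S = fixed_points C K"
  define I where "I = top_of_set C interior_of S"
  have SC: "S \<subseteq> C" by (auto simp: S_def fixed_points_def)
  have S: "x \<in> S \<longleftrightarrow> x \<in> C \<and> x \<in> K x" for x by (auto simp: S_def fixed_points_def)
  have clS: "closedin (top_of_set C) S" using assms(8) by (simp add: S_def)
  have IS: "I \<subseteq> S" and opI: "openin (top_of_set C) I"
    by (auto simp: I_def interior_of_subset)
  have KC: "K x \<subseteq> C" if "x \<in> C" for x using assms(4) that by auto
  have FC: "F x = {y \<in> C. f x y < 0}" if "x \<in> C" for x using assms(5) that by simp
  have FK: "F x \<inter> K x \<noteq> {}" if "x \<in> S" for x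
  proof -
    obtain y where "y \<in> K x" "f x y < 0" using no S[of x] \<open>x \<in> S\<close> by (meson not_le)
    then show ?thesis using KC[of x] FC[of x] S[of x] \<open>x \<in> S\<close> by blast
  qed
  have xF: "x \<notin> F x" if "x \<in> C" for x using FC[OF that] assms(3) that by auto
  have convF: "convex (F x)" if "x \<in> S" for x using assms(9) that by (simp add: S_def)
  have ols: "open_lower_sections_on (top_of_set C) (top_of_set C) F S"
    using assms(10) by (simp add: S_def)
  \<comment> \<open>Since \<open>S\<close> is closed in \<open>C\<close>, its relative boundary is
    exactly \<open>S - I\<close>.\<close>
  have openF: "openin (top_of_set C) (F x)" if "x \<in> S - I" for x
    using assms(11) that clS by (simp add: S_def I_def frontier_of_def closure_of_closedin)
  \<comment> \<open>As the values of \<open>K\<close> lie in \<open>C\<close>, open sets of the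
    whole space can serve as test sets.\<close>
  have lscK: "\<exists>U. openin (top_of_set C) U \<and> x \<in> U \<and> (\<forall>x'\<in>U. K x' \<inter> \<Omega> \<noteq> {})"
    if "x \<in> C" "open \<Omega>" "K x \<inter> \<Omega> \<noteq> {}" for x \<Omega>
  proof -
    have "openin (top_of_set C) (C \<inter> \<Omega>)" "K x \<inter> (C \<inter> \<Omega>) \<noteq> {}"
      using that KC[OF that(1)] by (auto simp: openin_open_Int)
    then show ?thesis
      using assms(6) that(1) unfolding lower_semicontinuous_def lower_semicontinuous_at_def
      by (fastforce dest!: spec[of _ "C \<inter> \<Omega>"])
  qed
  \<comment> \<open>On \<open>I\<close> open lower sections already make \<open>F\<close> lower
    semicontinuous. On the boundary the intersection with \<open>K\<close> is required because
    nearby points may lie off \<open>S\<close>, and the openness of \<open>F x\<close> there makes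
    this intersection behave well.\<close>
  define G where "G x = (if x \<in> I then F x else if x \<in> S then F x \<inter> K x else K x)" for x
  have "lower_semicontinuous (top_of_set C) euclidean G"
  proof (rule lower_semicontinuous_onI)
    fix x \<Omega> assume x: "x \<in> C" and \<Omega>: "open \<Omega>" "G x \<inter> \<Omega> \<noteq> {}"
    then obtain y where y: "y \<in> G x" "y \<in> \<Omega>" by blast
    consider "x \<in> I" | "x \<in> S - I" | "x \<in> C - S" using x by blast
    then show "\<exists>U. openin (top_of_set C) U \<and> x \<in> U \<and> (\<forall>x'\<in>U. G x' \<inter> \<Omega> \<noteq> {})"
    proof cases
      case 1
      then have yF: "y \<in> F x" "y \<in> C" using y FC[OF x] by (auto simp: G_def)
      then have "openin (subtopology (top_of_set C) S) (lower_section (top_of_set C) F y \<inter> S)"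
        using ols by (simp add: open_lower_sections_on_def)
      then obtain T where T: "openin (top_of_set C) T" "lower_section (top_of_set C) F y \<inter> S = T \<inter> S"
        by (auto simp: openin_subtopology)
      have "x \<in> T" using T(2) yF x 1 IS by (auto simp: lower_section_def)
      moreover have "y \<in> G x'" if "x' \<in> T \<inter> I" for x'
        using that T(2) IS by (auto simp: lower_section_def G_def)
      ultimately show ?thesis using T(1) opI 1 y(2) by (intro exI[of _ "T \<inter> I"]) blast
    next
      case 2
      then have yF: "y \<in> F x" "y \<in> K x" using y by (auto simp: G_def)
      \<comment> \<open>Points near \<open>x\<close> may fall under any branch of \<open>G\<close>.
        Since \<open>F x'\<close> contains \<open>C \<inter> V\<close> for nearby \<open>x'\<close>
        in \<open>S\<close>, a point of \<open>K x'\<close> in \<open>V \<inter> \<Omega>\<close>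
        lies in \<open>G x'\<close> whichever branch applies.\<close>
      obtain U V where UV: "openin (top_of_set S) U" "x \<in> U" "open V" "y \<in> V"
          "\<And>x'. x' \<in> U \<Longrightarrow> C \<inter> V \<subseteq> F x'"
        using open_lower_sections_uniform_neighbourhood[OF assms(1) ols SC convF _ openF[OF 2] yF(1)] 2
        by blast
      obtain T where T: "open T" "U = S \<inter> T" using UV(1) by (auto simp: openin_open)
      obtain N where N: "openin (top_of_set C) N" "x \<in> N" "\<forall>x'\<in>N. K x' \<inter> (V \<inter> \<Omega>) \<noteq> {}"
        using lscK[OF x, of "V \<inter> \<Omega>"] UV \<Omega>(1) y(2) yF(2) by blast
      have "G x' \<inter> \<Omega> \<noteq> {}" if x': "x' \<in> N \<inter> (C \<inter> T)" for x'
      proof -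
        obtain u where u: "u \<in> K x'" "u \<in> V" "u \<in> \<Omega>" using N(3) x' by blast
        have "u \<in> F x'" if "x' \<in> S" using UV(5)[of x'] T(2) that x' u KC[of x'] by blast
        then have "u \<in> G x'" using u IS by (auto simp: G_def)
        then show ?thesis using u by blast
      qed
      then show ?thesis using N T UV(2) x
        by (intro exI[of _ "N \<inter> (C \<inter> T)"]) (auto intro!: openin_Int openin_open_Int)
    next
      case 3
      then have "x \<notin> I" "x \<notin> S" using IS by auto
      then have "K x \<inter> \<Omega> \<noteq> {}" using \<Omega>(2) by (simp add: G_def)
      then obtain U where U: "openin (top_of_set C) U" "x \<in> U" "\<forall>x'\<in>U. K x' \<inter> \<Omega> \<noteq> {}"
        using lscK[OF x \<Omega>(1)] by blast
      have "openin (top_of_set C) (C - S)" using clS by (simp add: closedin_def)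
      moreover have "G x' = K x'" if "x' \<in> C - S" for x' using that IS by (auto simp: G_def)
      ultimately show ?thesis using U 3 by (intro exI[of _ "U \<inter> (C - S)"]) auto
    qed
  qed
  moreover have "G x \<noteq> {} \<and> convex (G x) \<and> G x \<subseteq> C" if "x \<in> C" for x
    using that FK[of x] convF[of x] KC[of x] FC[of x] assms(7) IS
    by (auto simp: G_def convex_Int)
  ultimately obtain x where x: "x \<in> C" "x \<in> G x"
    using lower_semicontinuous_fixed_point[of C G] assms(1,2)
    by (metis polytope_imp_compact polytope_imp_convex)
  then show False using xF[of x] S[of x] by (auto simp: G_def split: if_splits)
qed

end
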